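(* Let $b_{n,k}$ denote the number of $321$-avoiding permutations of length $n$ in which the longest increasing subsequence is of length $k$. Then for any fixed positive integer $n$, the sequence $(b_{n,k})_{n/2\le k\le n}$ is log-concave.
   Context: A finite sequence of positive real numbers $(a_k)$ is log-concave if $a_{k-1}a_{k+1}\le a_k^2$ for all indices $k$ such that $k-1$, $k$, $k+1$ are all in the index range. Here $k$ ranges over the integers in $[n/2,n]$. A permutation of $\{1,\dots,n\}$ is $321$-avoiding if it has no decreasing subsequence of length $3$. *)

theory Defs
  imports Complex_Main "HOL-Combinatorics.Permutations"
begin

text \<open>
  A permutation of length \<open>n\<close> is a function \<open>p\<close> with \<open>p permutes {1..n}\<close>, its one-line notation
  being \<open>p 1, \<dots>, p n\<close>. A subsequence of it is given by its set of positions
  \<open>S \<subseteq> {1..n}\<close>, and its length is \<open>card S\<close>.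
\<close>

definition avoids_321 :: "nat \<Rightarrow> (nat \<Rightarrow> nat) \<Rightarrow> bool" where
  "avoids_321 n p \<longleftrightarrow> \<not> (\<exists>S \<subseteq> {1..n}. card S = 3 \<and> strict_antimono_on S p)"

definition lis :: "nat \<Rightarrow> (nat \<Rightarrow> nat) \<Rightarrow> nat" where
  "lis n p = Max {card S |S. S \<subseteq> {1..n} \<and> strict_mono_on S p}"

definition b :: "nat \<Rightarrow> nat \<Rightarrow> nat" where
  "b n k = card {p. p permutes {1..n} \<and> avoids_321 n p \<and> lis n p = k}"

text \<open>
  Log-concavity of a sequence of positive reals indexed by \<open>I\<close>; positivity of the terms is part of
  the notion. The guard \<open>1 \<le> k\<close> excludes the truncated subtraction \<open>0 - 1 = 0\<close>.
\<close>

definition log_concave_on :: "nat set \<Rightarrow> (nat \<Rightarrow> real) \<Rightarrow> bool" where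
  "log_concave_on I a \<longleftrightarrow>
     (\<forall>k\<in>I. 0 < a k) \<and>
     (\<forall>k. 1 \<le> k \<and> k - 1 \<in> I \<and> k \<in> I \<and> k + 1 \<in> I \<longrightarrow> a (k - 1) * a (k + 1) \<le> (a k)\<^sup>2)"

end

theory Submission
  imports Defs
begin

text \<open>
  Robinson--Schensted row insertion sends the \<open>321\<close>-avoiding permutations of \<open>{1..n}\<close> with
  longest increasing subsequence of length \<open>k\<close> bijectively to the pairs of standard Young tableaux
  of shape \<open>(k, n - k)\<close>.  If \<open>f n k\<close> is the number of such tableaux, then \<open>b n k = (f n k)\<^sup>2\<close>
  (\<open>b_eq_ballot_squared\<close>).  A two-row standard tableau is the same as a ballot sequence, so
  \<open>f n k\<close> is the ballot number \<open>(n choose k) - (n choose (k + 1))\<close>, and log-concavity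
  of the ballot numbers, hence of their squares, can be read off from that product formula.

  The correspondence is used in a form that needs no recording tableau.  Only the first row \<open>A\<close>
  of the insertion tableau of a word is tracked; the second row consists of the remaining letters
  \<open>C - A\<close>.  Three facts about the first row drive the proof.

  \<^item> Its number of entries below \<open>v\<close> is the length of a longest increasing subsequence with values
    below \<open>v\<close> (\<open>increasing_card_le_first_row\<close>, \<open>increasing_card_eq_first_row\<close>).
  \<^item> Whether a word stays \<open>321\<close>-avoiding when a letter is appended can be decided from the two rows
    alone (\<open>sorted_above_iff_fits\<close>): the bumped letter must exceed the second row.
  \<^item> Reverse bumping: for each corner of the shape of \<open>(A, C - A)\<close> there are exactly one letter and
    one pair of rows such that inserting the letter gives \<open>(A, C - A)\<close> and adds this corner
    (\<open>insert_row_reverse\<close>, \<open>insert_row_Max\<close>, \<open>insert_row_unbump\<close>).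

  By the third fact the number of words with given rows satisfies the recurrence of the
  ballot numbers (\<open>card_words_with_row\<close>), whatever the letters are.  Summing over the standard
  tableaux of shape \<open>(k, n - k)\<close>, of which there are equally many, gives the square.
\<close>

section \<open>Ballot numbers\<close>

text \<open>
  The number of two-row standard tableaux with \<open>n\<close> cells and \<open>k\<close> of them in the first row.
\<close>

primrec ballot :: "nat \<Rightarrow> nat \<Rightarrow> nat" where
  "ballot 0 k = (if k = 0 then 1 else 0)"
| "ballot (Suc n) k = (if 2 * k < Suc n then 0 else ballot n k + ballot n (k - 1))"

lemma ballot_eq_0: "2 * k < n \<Longrightarrow> ballot n k = 0"
  by (cases n) auto

lemma ballot_eq_0_if_less: "n < k \<Longrightarrow> ballot n k = 0"
  by (induction n arbitrary: k) auto

text \<open>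
  The range of validity is one step larger than that of the tableaux: for \<open>n = 2 * k + 1\<close> both
  sides vanish, the right-hand side by the symmetry of the binomial coefficients.  The extra step
  is what lets the induction hypothesis apply to \<open>k - 1\<close>.
\<close>

lemma ballot_eq_binomial_diff:
  assumes "n \<le> 2 * k + 1"
  shows "int (ballot n k) = int (n choose k) - int (n choose Suc k)"
  using assms
proof (induction n arbitrary: k)
  case 0
  then show ?case by simp
next
  case (Suc n)
  show ?case
  proof (cases "2 * k < Suc n")
    case True
    then have "Suc n = k + Suc k" using Suc.prems by simp
    then have "(Suc n choose k) = (Suc n choose Suc k)"
      using binomial_symmetric[of k "Suc n"] by simp
    then show ?thesis using True by simp
  next
    case False
    then obtain j where k: "k = Suc j" by (cases k) auto
    show ?thesis using Suc.IH[of k] Suc.IH[of j] False by (simp add: k)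
  qed
qed

lemma binomial_Suc_absorption:
  assumes "k \<le> n"
  shows "(real k + 1) * real (n choose Suc k) = (real n - real k) * real (n choose k)"
proof -
  have "Suc k * (n choose Suc k) = (n - k) * (n choose k)"
    by (metis binomial_absorb_comp binomial_absorption mult.commute)
  then have "real (Suc k * (n choose Suc k)) = real ((n - k) * (n choose k))" by (rule arg_cong)
  then show ?thesis using assms by (simp add: of_nat_diff algebra_simps)
qed

lemma ballot_closed_form:
  assumes "n \<le> 2 * k + 1" "k \<le> n"
  shows "(real k + 1) * real (ballot n k) = (2 * real k + 1 - real n) * real (n choose k)"
proof -
  have "real (ballot n k) = real_of_int (int (ballot n k))" by simp
  also have "\<dots> = real (n choose k) - real (n choose Suc k)"
    by (simp only: ballot_eq_binomial_diff[OF assms(1)] of_int_diff of_int_of_nat_eq)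
  finally have f: "real (ballot n k) = real (n choose k) - real (n choose Suc k)" .
  show ?thesis using binomial_Suc_absorption[OF assms(2)] by (simp add: f algebra_simps)
qed

lemma ballot_pos:
  assumes "n \<le> 2 * k" "k \<le> n"
  shows "0 < ballot n k"
proof -
  have "0 < (2 * real k + 1 - real n) * real (n choose k)"
    using assms by (intro mult_pos_pos) auto
  then have "0 < (real k + 1) * real (ballot n k)"
    using ballot_closed_form[of n k] assms by simp
  then show ?thesis by (simp add: zero_less_mult_iff)
qed

text \<open>
  With \<open>d = 2 * k + 1 - n\<close> and \<open>m = n - k\<close> the closed form gives
  \<open>(d\<^sup>2 - 4) / d\<^sup>2 * (m / (m + 1)) * ((k + 1) / (k + 2))\<close> as the quotient of the two sides, a product
  of three factors that are at most \<open>1\<close>.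
\<close>

lemma ballot_log_concave:
  assumes "n \<le> 2 * (k - 1)" "1 \<le> k" "k + 1 \<le> n"
  shows "ballot n (k - 1) * ballot n (k + 1) \<le> (ballot n k)\<^sup>2"
proof -
  obtain j where k: "k = Suc j" using assms(2) by (cases k) auto
  define x where "x = real k"
  define m where "m = real n - x"
  define c where "c = real (n choose k)"
  define d where "d = 2 * x + 1 - real n"
  have "n \<le> 2 * j" using assms(1) k by simp
  then have "real n \<le> real (2 * j)" by (simp only: of_nat_le_iff)
  then have x: "1 \<le> x" and m: "1 \<le> m" and c: "0 < c" and d: "2 < d"
    using assms(3) by (auto simp: x_def m_def c_def d_def k)
  have cm: "x * c = (m + 1) * real (n choose j)"
    using binomial_Suc_absorption[of j n] assms by (simp add: x_def m_def c_def k algebra_simps)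
  have cp: "(x + 1) * real (n choose Suc k) = m * c"
    using binomial_Suc_absorption[of k n] assms by (simp add: x_def m_def c_def)
  have f: "(x + 1) * real (ballot n k) = d * c"
    using ballot_closed_form[of n k] assms by (simp add: x_def c_def d_def)
  have fm: "x * real (ballot n j) = (d - 2) * real (n choose j)"
    using ballot_closed_form[of n j] assms k by (simp add: x_def d_def algebra_simps)
  have fp: "(x + 2) * real (ballot n (Suc k)) = (d + 2) * real (n choose Suc k)"
    using ballot_closed_form[of n "Suc k"] assms by (simp add: x_def d_def algebra_simps)
  have fm': "real (ballot n j) = (d - 2) * c / (m + 1)"
  proof -
    have "x * ((m + 1) * real (ballot n j)) = x * ((d - 2) * c)"
      using fm cm by (metis mult.left_commute)
    then have "(m + 1) * real (ballot n j) = (d - 2) * c"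
      using x by (simp only: mult_cancel_left) simp
    then show ?thesis using m by (simp add: field_simps)
  qed
  have fp': "real (ballot n (Suc k)) = (d + 2) * (m * c) / ((x + 1) * (x + 2))"
  proof -
    have "(x + 1) * ((x + 2) * real (ballot n (Suc k))) = (d + 2) * (m * c)"
      using fp cp by (metis mult.left_commute)
    moreover have "(x + 1) * (x + 2) \<noteq> 0" using x by auto
    ultimately show ?thesis
      by (intro nonzero_eq_divide_eq[THEN iffD2]) (simp_all only: mult_ac not_False_eq_True)
  qed
  have f': "real (ballot n k) = d * c / (x + 1)" using f x by (simp add: field_simps)
  have "real (ballot n j) * real (ballot n (Suc k))
      = (d\<^sup>2 - 4) * c\<^sup>2 * (m / (m + 1)) / ((x + 1) * (x + 2))"
    unfolding fm' fp' by (simp add: divide_inverse power2_eq_square algebra_simps)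
  also have "\<dots> \<le> d\<^sup>2 * c\<^sup>2 * 1 / ((x + 1) * (x + 1))"
    using x m by (intro frac_le mult_mono mult_nonneg_nonneg) auto
  also have "\<dots> = (real (ballot n k))\<^sup>2"
    unfolding f' by (simp add: power2_eq_square)
  finally have "real (ballot n j * ballot n (Suc k)) \<le> real ((ballot n k)\<^sup>2)" by simp
  then show ?thesis by (simp only: of_nat_le_iff k) simp
qed

section \<open>Row insertion\<close>

text \<open>
  Words are lists in reverse order: the head is the last letter.  Appending a letter to the word
  is then \<open>Cons\<close>.  A letter \<open>x\<close> of the row \<open>A\<close> is bumped by \<open>a\<close> if it is the least one above \<open>a\<close>;
  the set comprehension keeps all the others.  Stating it without the minimum covers the case that
  nothing is bumped.
\<close>

definition insert_row :: "nat \<Rightarrow> nat set \<Rightarrow> nat set" where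
  "insert_row a A = insert a {x \<in> A. x < a \<or> (\<exists>y\<in>A. a < y \<and> y < x)}"

primrec first_row :: "nat list \<Rightarrow> nat set" where
  "first_row [] = {}"
| "first_row (a # w) = insert_row a (first_row w)"

primrec avoiding :: "nat list \<Rightarrow> bool" where
  "avoiding [] = True"
| "avoiding (a # w) = (avoiding w \<and> sorted_wrt (>) (filter ((<) a) w))"

text \<open>
  Rows \<open>A\<close> and \<open>C - A\<close> of increasing letters form a tableau, with the columns increasing as well,
  exactly if no initial segment of the letters has more of them in the second row than in the first.
\<close>

definition tableau :: "nat set \<Rightarrow> nat set \<Rightarrow> bool" where
  "tableau A C \<longleftrightarrow> finite C \<and> A \<subseteq> C \<and> (\<forall>v. card (C \<inter> {..<v}) \<le> 2 * card (A \<inter> {..<v}))"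

text \<open>
  Inserting \<open>a\<close> bumps nothing, or a letter larger than the whole second row, so that this letter
  can be placed at the end of the second row.
\<close>

definition fits :: "nat \<Rightarrow> nat set \<Rightarrow> nat set \<Rightarrow> bool" where
  "fits a A C \<longleftrightarrow> (\<forall>x\<in>A. a < x \<longrightarrow> (\<forall>y\<in>C - A. y < x))"

lemma insert_row_cases:
  assumes "finite A" "a \<notin> A"
  obtains (append) "\<forall>x\<in>A. x < a" "insert_row a A = insert a A"
  | (bump) b where "b \<in> A" "a < b" "\<forall>x\<in>A. a < x \<longrightarrow> b \<le> x" "insert_row a A = insert a (A - {b})"
proof (cases "\<exists>x\<in>A. a < x")
  case True
  define b where "b = (LEAST x. x \<in> A \<and> a < x)"
  have b: "b \<in> A \<and> a < b" unfolding b_def by (rule LeastI_ex) (use True in blast)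
  have le: "\<forall>x\<in>A. a < x \<longrightarrow> b \<le> x" unfolding b_def by (auto intro: Least_le)
  have "x < a \<or> (\<exists>y\<in>A. a < y \<and> y < x) \<longleftrightarrow> x \<noteq> b" if "x \<in> A" for x
    using that b le assms(2) by (metis leD linorder_neqE_nat order_less_imp_not_less)
  then have "insert_row a A = insert a (A - {b})"
    unfolding insert_row_def by blast
  then show ?thesis using bump b le by blast
next
  case False
  then have "\<forall>x\<in>A. x < a" using assms(2) by (metis linorder_cases)
  moreover from this have "insert_row a A = insert a A" by (auto simp: insert_row_def)
  ultimately show ?thesis by (rule append)
qed

lemma first_row_subset: "first_row w \<subseteq> set w"
  by (induction w) (auto simp: insert_row_def)

lemma finite_first_row [simp]: "finite (first_row w)"
  using first_row_subset finite_subset by blast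

lemma insert_row_below: "v \<le> a \<Longrightarrow> insert_row a A \<inter> {..<v} = A \<inter> {..<v}"
  by (auto simp: insert_row_def)

text \<open>
  This mirrors the recurrence for longest increasing subsequences with values below \<open>v\<close>: such a
  subsequence either omits the new letter \<open>a\<close> or ends with it.
\<close>

lemma card_insert_row_below:
  assumes "finite A" "a \<notin> A" "a < v"
  shows "card (insert_row a A \<inter> {..<v}) = max (card (A \<inter> {..<v})) (Suc (card (A \<inter> {..<a})))"
  using assms(1,2)
proof (cases rule: insert_row_cases)
  case append
  have "insert_row a A \<inter> {..<v} = insert a (A \<inter> {..<a})" "A \<inter> {..<v} = A \<inter> {..<a}"
    using append assms(3) by auto
  then show ?thesis using assms by simp
next
  case (bump b)
  show ?thesis
  proof (cases "b < v")
    case True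
    have "insert_row a A \<inter> {..<v} = insert a (A \<inter> {..<v} - {b})"
      using bump assms(3) by auto
    moreover have "b \<in> A \<inter> {..<v}" using bump True by simp
    ultimately have *: "card (insert_row a A \<inter> {..<v}) = card (A \<inter> {..<v})"
      using assms card_Suc_Diff1[of "A \<inter> {..<v}" b] by simp
    have "insert b (A \<inter> {..<a}) \<subseteq> A \<inter> {..<v}" using bump True assms(3) by auto
    then have "card (insert b (A \<inter> {..<a})) \<le> card (A \<inter> {..<v})"
      using assms by (intro card_mono) auto
    then have "Suc (card (A \<inter> {..<a})) \<le> card (A \<inter> {..<v})"
      using bump assms by simp
    then show ?thesis using * by simp
  next
    case False
    have below: "x < a" if "x \<in> A" "x < v" for x
    proof (rule ccontr)
      assume "\<not> x < a"
      then have "a < x" using that(1) assms(2) by (metis linorder_neqE_nat)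
      then show False using bump(3) that False by force
    qed
    have "A \<inter> {..<v} = A \<inter> {..<a}"
      using below assms(3) by auto
    moreover have "insert_row a A \<inter> {..<v} = insert a (A \<inter> {..<v})"
      unfolding bump(4) using False assms(3) by auto
    ultimately have "insert_row a A \<inter> {..<v} = insert a (A \<inter> {..<a})"
      "A \<inter> {..<v} = A \<inter> {..<a}" by simp_all
    then show ?thesis using assms by simp
  qed
qed

section \<open>Avoidance of \<open>321\<close> in terms of the rows\<close>

text \<open>
  Let \<open>M\<close> be the largest letter of the second row.  The largest letter that is the lower end of
  an inversion of the word is the largest letter of the first row below \<open>M\<close>.  This is kept
  when a letter \<open>c\<close> is appended: if \<open>c\<close> bumps \<open>b\<close>, then \<open>b\<close> becomes the new \<open>M\<close> and \<open>c\<close> the lower end;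
  if \<open>c\<close> goes to the end of the first row, it is the lower end of an inversion just in case \<open>c < M\<close>.
\<close>

lemma sorted_above_iff_fits:
  assumes "avoiding w" "distinct w"
  shows "sorted_wrt (>) (filter ((<) a) w) \<longleftrightarrow> fits a (first_row w) (set w)"
  using assms
proof (induction w arbitrary: a)
  case Nil
  then show ?case by (simp add: fits_def)
next
  case (Cons c w)
  let ?A = "first_row w"
  have sub: "?A \<subseteq> set w" by (rule first_row_subset)
  have w: "avoiding w" "distinct w" and c: "c \<notin> set w"
    and sc: "sorted_wrt (>) (filter ((<) c) w)"
    using Cons.prems by simp_all
  note IH = Cons.IH[OF w]
  have fc: "fits c ?A (set w)" using sc unfolding IH .
  have "c \<notin> ?A" using c sub by blast
  have "sorted_wrt (>) (filter ((<) a) (c # w)) \<longleftrightarrow>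
      sorted_wrt (>) (filter ((<) a) w) \<and> (a < c \<longrightarrow> (\<forall>y\<in>set w. a < y \<longrightarrow> y < c))"
    by auto
  also have "\<dots> \<longleftrightarrow> fits a ?A (set w) \<and> (a < c \<longrightarrow> (\<forall>y\<in>set w. y < c))"
    unfolding IH by (meson linorder_not_less order_le_less_trans)
  finally have split: "sorted_wrt (>) (filter ((<) a) (c # w)) \<longleftrightarrow>
      fits a ?A (set w) \<and> (a < c \<longrightarrow> (\<forall>y\<in>set w. y < c))" .
  show ?case
    using finite_first_row \<open>c \<notin> ?A\<close>
  proof (cases rule: insert_row_cases)
    case append
    have "fits a (insert c ?A) (insert c (set w)) \<longleftrightarrow>
        fits a ?A (set w) \<and> (a < c \<longrightarrow> (\<forall>y\<in>set w. y < c))"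
    proof -
      have "insert c (set w) - insert c ?A = set w - ?A" using c by blast
      moreover have "(\<forall>y\<in>set w. y < c) \<longleftrightarrow> (\<forall>y\<in>set w - ?A. y < c)"
        using append(1) by blast
      ultimately show ?thesis by (auto simp: fits_def)
    qed
    then show ?thesis by (simp only: split first_row.simps list.set append(2))
  next
    case (bump b)
    have bw: "b \<in> set w" using bump sub by blast
    have above: "x = b \<or> b < x" if "x \<in> ?A" "c < x" for x
      using bump(3) that by (metis le_neq_implies_less)
    show ?thesis
    proof (cases "a < c")
      case True
      have "\<not> fits a (insert c (?A - {b})) (insert c (set w))"
      proof
        assume "fits a (insert c (?A - {b})) (insert c (set w))"
        moreover have "b \<in> insert c (set w) - insert c (?A - {b})" using bump(2) bw by auto
        ultimately have "b < c" using True unfolding fits_def by blast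
        then show False using bump(2) by simp
      qed
      moreover have "\<not> (\<forall>y\<in>set w. y < c)" using bump(2) bw order.asym by blast
      ultimately show ?thesis
        using True by (simp only: split first_row.simps list.set bump(4) simp_thms)
    next
      case False
      have "fits a ?A (set w)"
        unfolding fits_def
      proof (intro ballI impI)
        fix x y assume xy: "x \<in> ?A" "a < x" "y \<in> set w - ?A"
        then have "c < x" using False by simp
        then show "y < x" using fc xy unfolding fits_def by blast
      qed
      moreover have "fits a (insert c (?A - {b})) (insert c (set w))"
        unfolding fits_def
      proof (intro ballI impI)
        fix x y
        assume "x \<in> insert c (?A - {b})" "a < x"
          and y: "y \<in> insert c (set w) - insert c (?A - {b})"
        then have x: "x \<in> ?A" "x \<noteq> b" "c < x" using False by auto
        have "y = b \<or> y \<in> set w - ?A" using y by blast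
        then show "y < x" using above[OF x(1,3)] x fc unfolding fits_def by blast
      qed
      ultimately show ?thesis
        using False by (simp only: split first_row.simps list.set bump(4) simp_thms)
    qed
  qed
qed

lemma tableau_insert_row:
  assumes "tableau A C" "a \<notin> C" "fits a A C"
  shows "tableau (insert_row a A) (insert a C)"
proof -
  have fin: "finite C" and sub: "A \<subseteq> C"
    and bal: "card (C \<inter> {..<v}) \<le> 2 * card (A \<inter> {..<v})" for v
    using assms(1) by (auto simp: tableau_def)
  have finA: "finite A" and aA: "a \<notin> A" using fin sub assms(2) finite_subset by auto
  have "card (insert a C \<inter> {..<v}) \<le> 2 * card (insert_row a A \<inter> {..<v})" for v
  proof (cases "v \<le> a")
    case True
    then have "insert a C \<inter> {..<v} = C \<inter> {..<v}" by auto
    then show ?thesis using bal insert_row_below[OF True] by simp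
  next
    case False
    then have "insert a C \<inter> {..<v} = insert a (C \<inter> {..<v})" by auto
    then have C: "card (insert a C \<inter> {..<v}) = Suc (card (C \<inter> {..<v}))"
      using fin assms(2) by simp
    have R: "card (insert_row a A \<inter> {..<v}) = max (card (A \<inter> {..<v})) (Suc (card (A \<inter> {..<a})))"
      using card_insert_row_below finA aA False by simp
    show ?thesis
    proof (cases "\<exists>b\<in>A. a < b \<and> b < v")
      case True
      then obtain b where b: "b \<in> A" "a < b" "b < v" by blast
      \<comment> \<open>Beyond \<open>b\<close> there are only letters of the first row, so the surplus of the first row
        grows by at least one between \<open>b\<close> and \<open>v\<close>.\<close>
      have "C \<inter> {..<v} = (C \<inter> {..<b}) \<union> (A \<inter> {b..<v})"
      proof -
        have "C \<subseteq> A \<union> {..<b}" using b assms(3) unfolding fits_def by blast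
        moreover have "{..<v} = {..<b} \<union> {b..<v}" using b(3) by auto
        ultimately show ?thesis using sub by blast
      qed
      moreover have "card ((C \<inter> {..<b}) \<union> (A \<inter> {b..<v})) = card (C \<inter> {..<b}) + card (A \<inter> {b..<v})"
        using finA fin by (intro card_Un_disjoint) auto
      ultimately have 1: "card (C \<inter> {..<v}) = card (C \<inter> {..<b}) + card (A \<inter> {b..<v})"
        by (simp only:)
      have "A \<inter> {..<v} = (A \<inter> {..<b}) \<union> (A \<inter> {b..<v})" using b by auto
      moreover have "card ((A \<inter> {..<b}) \<union> (A \<inter> {b..<v})) = card (A \<inter> {..<b}) + card (A \<inter> {b..<v})"
        using finA by (intro card_Un_disjoint) auto
      ultimately have 2: "card (A \<inter> {..<v}) = card (A \<inter> {..<b}) + card (A \<inter> {b..<v})"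
        by (simp only:)
      have "0 < card (A \<inter> {b..<v})" using b finA by (auto simp: card_gt_0_iff)
      then show ?thesis using 1 2 C R bal[of b] by linarith
    next
      case False
      then have "\<forall>x\<in>A. x < v \<longrightarrow> x < a" using aA by (metis linorder_neqE_nat)
      then have "A \<inter> {..<v} = A \<inter> {..<a}" using \<open>\<not> v \<le> a\<close> by auto
      then show ?thesis using C R bal[of v] by simp
    qed
  qed
  moreover have "insert_row a A \<subseteq> insert a C" using sub by (auto simp: insert_row_def)
  ultimately show ?thesis using fin by (simp add: tableau_def)
qed

lemma tableau_first_row:
  assumes "avoiding w" "distinct w"
  shows "tableau (first_row w) (set w)"
  using assms
proof (induction w)
  case Nil
  then show ?case by (simp add: tableau_def)
next
  case (Cons a w)
  then have w: "avoiding w" "distinct w" and a: "a \<notin> set w"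
    and sorted: "sorted_wrt (>) (filter ((<) a) w)" by auto
  have "fits a (first_row w) (set w)" using sorted sorted_above_iff_fits[OF w] by blast
  then show ?case using tableau_insert_row[OF Cons.IH[OF w] a] by simp
qed

section \<open>Reverse bumping and the number of words with given rows\<close>

definition words_with_row :: "nat set \<Rightarrow> nat set \<Rightarrow> nat list set" where
  "words_with_row A C = {w. distinct w \<and> avoiding w \<and> set w = C \<and> first_row w = A}"

lemma finite_words_with_row: "finite C \<Longrightarrow> finite (words_with_row A C)"
  by (rule finite_subset[of _ "{w. set w \<subseteq> C \<and> distinct w}"])
    (auto simp: words_with_row_def finite_subset_distinct)

lemma Cons_in_words_with_row_iff:
  "a # w \<in> words_with_row A C \<longleftrightarrow>
     a \<in> C \<and> w \<in> words_with_row (first_row w) (C - {a}) \<and>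
     fits a (first_row w) (C - {a}) \<and> insert_row a (first_row w) = A"
proof -
  have set: "a \<notin> set w \<and> insert a (set w) = C \<longleftrightarrow> a \<in> C \<and> set w = C - {a}" by blast
  have "a # w \<in> words_with_row A C \<longleftrightarrow>
      (a \<notin> set w \<and> insert a (set w) = C) \<and> distinct w \<and> avoiding w \<and>
      sorted_wrt (>) (filter ((<) a) w) \<and> insert_row a (first_row w) = A"
    by (simp add: words_with_row_def conj_ac)
  also have "\<dots> \<longleftrightarrow> (a \<notin> set w \<and> insert a (set w) = C) \<and> distinct w \<and> avoiding w \<and>
      fits a (first_row w) (set w) \<and> insert_row a (first_row w) = A"
    by (metis sorted_above_iff_fits)
  also have "\<dots> \<longleftrightarrow> a \<in> C \<and> w \<in> words_with_row (first_row w) (C - {a}) \<and>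
      fits a (first_row w) (C - {a}) \<and> insert_row a (first_row w) = A"
    unfolding set words_with_row_def mem_Collect_eq by metis
  finally show ?thesis .
qed

lemma words_with_row_empty_unless_tableau:
  "\<not> tableau A C \<Longrightarrow> words_with_row A C = {}"
  using tableau_first_row by (auto simp: words_with_row_def)

text \<open>
  Undoing an insertion: either the last letter of the first row was appended, or the last letter
  \<open>b\<close> of the second row was bumped, in which case it was bumped by the largest letter of the
  first row below \<open>b\<close>.
\<close>

lemma insert_row_reverse:
  assumes "finite C" "A' \<subseteq> C - {a}" "a \<in> C" "fits a A' (C - {a})" "insert_row a A' = A"
  shows "a = Max A \<and> A' = A - {a} \<or>
    C - A \<noteq> {} \<and> a = Max {x \<in> A. x < Max (C - A)} \<and> A' = insert (Max (C - A)) (A - {a})"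
proof -
  have fin: "finite A'" and a: "a \<notin> A'" using assms finite_subset by auto
  then show ?thesis
  proof (cases rule: insert_row_cases)
    case append
    then have A: "A = insert a A'" by (simp only: assms(5)[symmetric])
    have "Max A = a"
      unfolding A
    proof (rule Max_eqI)
      show "y \<le> a" if "y \<in> insert a A'" for y using append(1) that less_imp_le by blast
    qed (use fin in auto)
    moreover have "A' = A - {a}" unfolding A using a by auto
    ultimately show ?thesis by blast
  next
    case (bump b)
    then have A: "A = insert a (A' - {b})" by (simp only: assms(5)[symmetric])
    have CA: "C - A = insert b (C - {a} - A')" unfolding A using bump(1,2) assms(2,3) by auto
    have M: "Max (C - A) = b"
      unfolding CA
    proof (rule Max_eqI)
      show "finite (insert b (C - {a} - A'))" using assms(1) by simp
      show "y \<le> b" if "y \<in> insert b (C - {a} - A')" for y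
      proof -
        have "y = b \<or> y < b" using that assms(4) bump(1,2) unfolding fits_def by blast
        then show ?thesis by auto
      qed
    qed simp
    have "Max {x \<in> A. x < b} = a"
    proof (rule Max_eqI)
      show "finite {x \<in> A. x < b}" using A fin by simp
      show "a \<in> {x \<in> A. x < b}" using A bump(2) by simp
      show "y \<le> a" if "y \<in> {x \<in> A. x < b}" for y
      proof -
        have "y = a \<or> y \<in> A'" "y < b" using that A by auto
        then show ?thesis using bump(3)[rule_format, of y] by linarith
      qed
    qed
    moreover have "A' = insert b (A - {a})" unfolding A using bump(1) a by auto
    moreover have "C - A \<noteq> {}" unfolding CA by blast
    ultimately show ?thesis unfolding M by blast
  qed
qed

lemma insert_row_Max:
  assumes "finite A" "A \<noteq> {}"
  shows "insert_row (Max A) (A - {Max A}) = A" "fits (Max A) (A - {Max A}) C"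
proof -
  have "\<forall>x\<in>A - {Max A}. x < Max A" using assms by (auto simp: order.strict_iff_order)
  then show "insert_row (Max A) (A - {Max A}) = A"
    using Max_in[OF assms] by (auto simp: insert_row_def)
  have "\<forall>x\<in>A. x \<le> Max A" using assms by simp
  then show "fits (Max A) (A - {Max A}) C"
    unfolding fits_def by (meson DiffD1 linorder_not_less)
qed

lemma insert_row_unbump:
  assumes "a \<in> A" "A \<subseteq> C" "c \<in> C - A" "a < c"
    and "\<And>x. x \<in> A \<Longrightarrow> x < c \<Longrightarrow> x \<le> a" "\<And>y. y \<in> C - A \<Longrightarrow> y \<le> c"
  shows "insert_row a (insert c (A - {a})) = A" "fits a (insert c (A - {a})) (C - {a})"
proof -
  have "x \<in> A \<Longrightarrow> x < a \<or> x = a \<or> c < x" for x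
    using assms(3) assms(5)[of x] by force
  then show "insert_row a (insert c (A - {a})) = A"
    using assms(1,3,4) unfolding insert_row_def by (auto dest: less_trans)
  show "fits a (insert c (A - {a})) (C - {a})"
    unfolding fits_def
  proof (intro ballI impI)
    fix x y
    assume x: "x \<in> insert c (A - {a})" "a < x" and y: "y \<in> C - {a} - insert c (A - {a})"
    have "c \<le> x" using x assms(5)[of x] by (auto simp: not_less[symmetric])
    moreover have "y \<in> C - A" "y \<noteq> c" using y by auto
    ultimately show "y < x" using assms(6)[of y] by simp
  qed
qed

text \<open>
  Both kinds of corner removal leave a tableau.  In the first row the cell can be removed only if
  that row is the longer one; in the second row this is always possible.
\<close>

lemma tableau_remove_Max:
  assumes "tableau A C" "A \<noteq> {}" "card C - 1 \<le> 2 * (card A - 1)"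
  shows "tableau (A - {Max A}) (C - {Max A})"
proof -
  have fin: "finite C" and sub: "A \<subseteq> C" and finA: "finite A"
    and bal: "card (C \<inter> {..<v}) \<le> 2 * card (A \<inter> {..<v})" for v
    using assms(1) by (auto simp: tableau_def intro: finite_subset)
  let ?a = "Max A"
  have a: "?a \<in> A" "\<And>x. x \<in> A \<Longrightarrow> x \<le> ?a" using finA assms(2) by auto
  have "card ((C - {?a}) \<inter> {..<v}) \<le> 2 * card ((A - {?a}) \<inter> {..<v})" for v
  proof (cases "v \<le> ?a")
    case True
    then have "(C - {?a}) \<inter> {..<v} = C \<inter> {..<v}" "(A - {?a}) \<inter> {..<v} = A \<inter> {..<v}" by auto
    then show ?thesis using bal by simp
  next
    case False
    then have "(A - {?a}) \<inter> {..<v} = A - {?a}" using a by force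
    moreover have "card ((C - {?a}) \<inter> {..<v}) \<le> card (C - {?a})"
      using fin by (intro card_mono) auto
    moreover have "card (C - {?a}) = card C - 1" "card (A - {?a}) = card A - 1"
      using a sub by (auto simp: card_Diff_singleton)
    ultimately show ?thesis using assms(3) by simp
  qed
  then show ?thesis using fin sub by (auto simp: tableau_def)
qed

lemma tableau_unbump:
  assumes "tableau A C" "a \<in> A" "c \<in> C - A" "a < c" "\<And>x. x \<in> A \<Longrightarrow> x < c \<Longrightarrow> x \<le> a"
  shows "tableau (insert c (A - {a})) (C - {a})"
proof -
  have fin: "finite C" and sub: "A \<subseteq> C" and finA: "finite A"
    and bal: "card (C \<inter> {..<v}) \<le> 2 * card (A \<inter> {..<v})" for v
    using assms(1) by (auto simp: tableau_def intro: finite_subset)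
  let ?A = "insert c (A - {a})"
  have "card ((C - {a}) \<inter> {..<v}) \<le> 2 * card (?A \<inter> {..<v})" for v
  proof -
    consider "v \<le> a" | "a < v" "v \<le> c" | "c < v" by linarith
    then show ?thesis
    proof cases
      case 1
      then have "(C - {a}) \<inter> {..<v} = C \<inter> {..<v}" "?A \<inter> {..<v} = A \<inter> {..<v}"
        using assms(4) by auto
      then show ?thesis using bal by simp
    next
      case 2
      \<comment> \<open>The balance is read off just after \<open>c\<close>, where one more letter of the second row is seen.\<close>
      have "c \<in> C \<inter> {..<Suc c}" "c \<notin> C \<inter> {..<v}" "C \<inter> {..<v} \<subseteq> C \<inter> {..<Suc c}"
        using 2 assms(3) by auto
      then have "C \<inter> {..<v} \<subset> C \<inter> {..<Suc c}" by blast
      then have lt: "card (C \<inter> {..<v}) < card (C \<inter> {..<Suc c})"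
        using fin by (intro psubset_card_mono) auto
      have "x < v \<longleftrightarrow> x < Suc c" if "x \<in> A" for x
      proof -
        have "x \<noteq> c" using that assms(3) by auto
        then show ?thesis using assms(5)[OF that] 2 by linarith
      qed
      then have "A \<inter> {..<v} = A \<inter> {..<Suc c}" by (auto simp only: Int_iff lessThan_iff)
      then have eq: "card (A \<inter> {..<v}) = card (A \<inter> {..<Suc c})" by (rule arg_cong)
      have "(C - {a}) \<inter> {..<v} = C \<inter> {..<v} - {a}" "?A \<inter> {..<v} = A \<inter> {..<v} - {a}"
        using 2 by auto
      moreover have "a \<in> C \<inter> {..<v}" "a \<in> A \<inter> {..<v}" using 2 assms(2) sub by auto
      ultimately have "card ((C - {a}) \<inter> {..<v}) = card (C \<inter> {..<v}) - 1"
        "card (?A \<inter> {..<v}) = card (A \<inter> {..<v}) - 1"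
        by (simp_all add: card_Diff_singleton)
      then show ?thesis using lt eq bal[of "Suc c"] by linarith
    next
      case 3
      have "card ((C - {a}) \<inter> {..<v}) \<le> card (C \<inter> {..<v})"
        using fin by (intro card_mono) auto
      moreover have "?A \<inter> {..<v} = insert c (A \<inter> {..<v} - {a})" using 3 by auto
      moreover have "a \<in> A \<inter> {..<v}" using 3 assms(2,4) by auto
      then have "Suc (card (A \<inter> {..<v} - {a})) = card (A \<inter> {..<v})"
        using finA by (intro card_Suc_Diff1) auto
      ultimately show ?thesis using bal[of v] assms(3) finA by simp
    qed
  qed
  then show ?thesis using fin sub assms(2-4) by (auto simp: tableau_def)
qed

text \<open>
  For each corner of the shape, the last letter and the rows of the remaining word are
  determined by reverse bumping, so the count satisfies the ballot recurrence in the
  shape alone.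
\<close>

lemma card_words_with_row:
  assumes "tableau A C"
  shows "card (words_with_row A C) = ballot (card C) (card A)"
  using assms
proof (induction "card C" arbitrary: A C)
  case 0
  then have "A = {}" "C = {}" by (auto simp: tableau_def)
  moreover have "words_with_row {} {} = {[]}" by (auto simp: words_with_row_def)
  ultimately show ?case by simp
next
  case (Suc n)
  have fin: "finite C" and sub: "A \<subseteq> C" and finA: "finite A"
    and bal: "card (C \<inter> {..<v}) \<le> 2 * card (A \<inter> {..<v})" for v
    using Suc.prems by (auto simp: tableau_def intro: finite_subset)
  have "C \<inter> {..<Suc (Max C)} = C" "A \<inter> {..<Suc (Max C)} = A"
    using fin sub by (auto simp: less_Suc_eq_le)
  then have len: "Suc n \<le> 2 * card A" using bal[of "Suc (Max C)"] Suc.hyps(2) by simp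
  then have ne: "A \<noteq> {}" by auto
  define a where "a = Max A"
  define B where "B = C - A"
  define b where "b = Max B"
  define a' where "a' = Max {x \<in> A. x < b}"
  define A' where "A' = insert b (A - {a'})"
  define U where "U = Cons a ` words_with_row (A - {a}) (C - {a})"
  define V where "V = (if B = {} then {} else Cons a' ` words_with_row A' (C - {a'}))"
  have aA: "a \<in> A" using finA ne by (simp add: a_def)
  have cards: "card (C - {x}) = n" if "x \<in> A" for x
    using that sub Suc.hyps(2) by (simp add: card_Diff_singleton subset_iff)
  have U: "card U = ballot n (card A - 1)"
  proof (cases "n \<le> 2 * (card A - 1)")
    case True
    then have "tableau (A - {a}) (C - {a})"
      unfolding a_def using Suc.prems Suc.hyps(2)[symmetric] ne by (intro tableau_remove_Max) auto
    then have "card (words_with_row (A - {a}) (C - {a})) = ballot n (card A - 1)"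
      using Suc.hyps(1)[of "C - {a}" "A - {a}"] cards[OF aA] aA by (simp add: card_Diff_singleton)
    then show ?thesis by (simp add: U_def card_image)
  next
    case False
    have "\<not> tableau (A - {a}) (C - {a})"
    proof
      assume "tableau (A - {a}) (C - {a})"
      then have "card ((C - {a}) \<inter> {..<Suc (Max C)}) \<le> 2 * card ((A - {a}) \<inter> {..<Suc (Max C)})"
        by (auto simp: tableau_def)
      moreover have "(C - {a}) \<inter> {..<Suc (Max C)} = C - {a}" "(A - {a}) \<inter> {..<Suc (Max C)} = A - {a}"
        using fin sub by (auto simp: less_Suc_eq_le)
      ultimately show False using False cards[OF aA] aA by (simp add: card_Diff_singleton)
    qed
    then show ?thesis using False ballot_eq_0[of "card A - 1" n]
      by (simp add: U_def words_with_row_empty_unless_tableau)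
  qed
  have corner: "b \<in> C - A \<and> (\<forall>y\<in>C - A. y \<le> b) \<and> a' \<in> A \<and> a' < b \<and> (\<forall>x\<in>A. x < b \<longrightarrow> x \<le> a')"
    if "B \<noteq> {}"
  proof -
    have b: "b \<in> C - A" "\<forall>y\<in>C - A. y \<le> b"
      using that fin Max_in[of B] by (auto simp: b_def B_def)
    have "C \<inter> {..<Suc b} \<noteq> {}" using b by auto
    then have "0 < card (C \<inter> {..<Suc b})" using fin by (simp add: card_gt_0_iff)
    then have "A \<inter> {..<Suc b} \<noteq> {}" using bal[of "Suc b"] by auto
    then have "{x \<in> A. x < b} \<noteq> {}" using b by (auto simp: less_Suc_eq)
    moreover have fx: "finite {x \<in> A. x < b}" using finA by simp
    ultimately have "a' \<in> {x \<in> A. x < b}" unfolding a'_def by (intro Max_in)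
    then show ?thesis using b fx by (auto simp: a'_def)
  qed
  have V: "card V = ballot n (card A)"
  proof (cases "B = {}")
    case True
    then have "card A = Suc n" using sub Suc.hyps(2) by (metis B_def Diff_eq_empty_iff subset_antisym)
    then show ?thesis using True by (simp add: V_def ballot_eq_0_if_less)
  next
    case False
    have "tableau A' (C - {a'})"
      unfolding A'_def using corner[OF False] Suc.prems by (intro tableau_unbump) auto
    moreover have "card A' = card A"
      unfolding A'_def using corner[OF False] finA
      by (metis DiffD2 Diff_iff card_Suc_Diff1 card_insert_disjoint finite_Diff)
    ultimately have "card (words_with_row A' (C - {a'})) = ballot n (card A)"
      using Suc.hyps(1)[of "C - {a'}" A'] cards[of a'] corner[OF False] by simp
    then show ?thesis using False by (simp add: V_def card_image)
  qed
  have "words_with_row A C = U \<union> V"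
  proof (intro equalityI subsetI)
    fix w assume w: "w \<in> words_with_row A C"
    have "w \<noteq> []" using w Suc.hyps(2) by (auto simp: words_with_row_def)
    then obtain c u where cu: "w = c # u" by (cases w) auto
    have u: "c \<in> C" "u \<in> words_with_row (first_row u) (C - {c})"
      "fits c (first_row u) (C - {c})" "insert_row c (first_row u) = A"
      using w unfolding cu Cons_in_words_with_row_iff by auto
    have "first_row u \<subseteq> C - {c}" using u(2) first_row_subset[of u] by (auto simp: words_with_row_def)
    then have "c = a \<and> first_row u = A - {c} \<or> B \<noteq> {} \<and> c = a' \<and> first_row u = insert b (A - {c})"
      using insert_row_reverse[OF fin _ u(1,3,4)] unfolding a_def B_def b_def a'_def by blast
    then show "w \<in> U \<union> V" using u(2) by (auto simp: cu U_def V_def A'_def)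
  next
    fix w assume "w \<in> U \<union> V"
    then show "w \<in> words_with_row A C"
    proof
      assume "w \<in> U"
      then obtain u where u: "w = a # u" "u \<in> words_with_row (A - {a}) (C - {a})"
        by (auto simp: U_def)
      then have "first_row u = A - {a}" by (simp add: words_with_row_def)
      then show ?thesis using u aA sub insert_row_Max[OF finA ne, folded a_def]
        by (auto simp: Cons_in_words_with_row_iff)
    next
      assume wV: "w \<in> V"
      then have B: "B \<noteq> {}" by (auto simp: V_def)
      then obtain u where u: "w = a' # u" "u \<in> words_with_row A' (C - {a'})"
        using wV by (auto simp: V_def)
      then have "first_row u = A'" by (simp add: words_with_row_def)
      then show ?thesis using u sub corner[OF B] insert_row_unbump[of a' A C b, folded A'_def]
        by (auto simp: Cons_in_words_with_row_iff)
    qed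
  qed
  moreover have "U \<inter> V = {}"
  proof -
    \<comment> \<open>The two corners leave first rows of different lengths; here: one contains \<open>b\<close>, the other not.\<close>
    have "b \<in> A'" "B \<noteq> {} \<Longrightarrow> b \<notin> A - {a}" using corner by (auto simp: A'_def)
    then have "B \<noteq> {} \<Longrightarrow> A' \<noteq> A - {a}" by blast
    then show ?thesis by (auto simp: U_def V_def words_with_row_def)
  qed
  moreover have "finite U" "finite V"
    using fin by (auto simp: U_def V_def finite_words_with_row)
  ultimately have "card (words_with_row A C) = ballot n (card A - 1) + ballot n (card A)"
    using U V by (simp add: card_Un_disjoint)
  then show ?case using len Suc.hyps(2)[symmetric] by simp
qed

text \<open>
  The new largest letter is not seen by the balance conditions for \<open>v \<le> n + 1\<close>, and those for larger
  \<open>v\<close> all compare the full lengths of the rows.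
\<close>

lemma tableau_Suc_iff:
  "tableau A {1..Suc n} \<longleftrightarrow> A \<subseteq> {1..Suc n} \<and> tableau (A - {Suc n}) {1..n} \<and> Suc n \<le> 2 * card A"
proof -
  have low: "{1..Suc n} \<inter> {..<v} = {1..n} \<inter> {..<v}" "A \<inter> {..<v} = (A - {Suc n}) \<inter> {..<v}"
    if "v \<le> Suc n" for v using that by auto
  have high: "{1..Suc n} \<inter> {..<v} = {1..Suc n}" "A \<inter> {..<v} = A"
    if "A \<subseteq> {1..Suc n}" "\<not> v \<le> Suc n" for v using that by force+
  have top: "{1..n} \<inter> {..<v} = {1..n} \<inter> {..<Suc n}"
    "(A - {Suc n}) \<inter> {..<v} = (A - {Suc n}) \<inter> {..<Suc n}"
    if "A \<subseteq> {1..Suc n}" "\<not> v \<le> Suc n" for v using that by force+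
  show ?thesis
  proof
    assume t: "tableau A {1..Suc n}"
    then have sub: "A \<subseteq> {1..Suc n}"
      and bal: "card ({1..Suc n} \<inter> {..<v}) \<le> 2 * card (A \<inter> {..<v})" for v
      by (auto simp: tableau_def)
    have le: "card ({1..n} \<inter> {..<v}) \<le> 2 * card ((A - {Suc n}) \<inter> {..<v})" if "v \<le> Suc n" for v
      using bal[of v] low[OF that] by simp
    have "card ({1..n} \<inter> {..<v}) \<le> 2 * card ((A - {Suc n}) \<inter> {..<v})" for v
    proof (cases "v \<le> Suc n")
      case False
      then show ?thesis using le[of "Suc n"] top[OF sub False] by (simp only: order_refl)
    qed (rule le)
    moreover have "Suc n \<le> 2 * card A"
      using bal[of "Suc (Suc n)"] high[OF sub, of "Suc (Suc n)"] by simp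
    moreover have "A - {Suc n} \<subseteq> {1..n}" using sub by auto
    ultimately show "A \<subseteq> {1..Suc n} \<and> tableau (A - {Suc n}) {1..n} \<and> Suc n \<le> 2 * card A"
      using sub by (auto simp: tableau_def)
  next
    assume "A \<subseteq> {1..Suc n} \<and> tableau (A - {Suc n}) {1..n} \<and> Suc n \<le> 2 * card A"
    then have sub: "A \<subseteq> {1..Suc n}" and len: "Suc n \<le> 2 * card A"
      and bal: "card ({1..n} \<inter> {..<v}) \<le> 2 * card ((A - {Suc n}) \<inter> {..<v})" for v
      by (auto simp: tableau_def)
    have "card ({1..Suc n} \<inter> {..<v}) \<le> 2 * card (A \<inter> {..<v})" for v
    proof (cases "v \<le> Suc n")
      case True
      then show ?thesis using bal[of v] low[OF True] by simp
    next
      case False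
      then show ?thesis using high[OF sub False] len by simp
    qed
    then show "tableau A {1..Suc n}" using sub by (simp add: tableau_def)
  qed
qed

text \<open>The largest letter \<open>n + 1\<close> of a standard tableau is the last one of its row.\<close>

lemma card_standard_tableaux: "card {A. tableau A {1..n} \<and> card A = k} = ballot n k"
proof (induction n arbitrary: k)
  case 0
  have "{A. tableau A {1..0} \<and> card A = k} = (if k = 0 then {{}} else {})"
    by (auto simp: tableau_def)
  then show ?case by simp
next
  case (Suc n)
  let ?T = "\<lambda>n k. {A. tableau A {1..n} \<and> card A = k}"
  have sub: "A \<subseteq> {1..n}" "finite A" if "A \<in> ?T n k" for A n k
  proof -
    show "A \<subseteq> {1..n}" using that by (simp add: tableau_def)
    then show "finite A" by (rule finite_subset) simp
  qed
  have fin: "finite (?T n k)" for n k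
    by (rule finite_subset[of _ "Pow {1..n}"]) (auto simp: tableau_def)
  show ?case
  proof (cases "2 * k < Suc n")
    case True
    then have "?T (Suc n) k = {}" unfolding tableau_Suc_iff by auto
    then show ?thesis using True by (simp only: card.empty ballot.simps if_True)
  next
    case False
    then have k: "0 < k" by simp
    have "?T (Suc n) k = ?T n k \<union> insert (Suc n) ` ?T n (k - 1)"
    proof (intro equalityI subsetI)
      fix A assume A: "A \<in> ?T (Suc n) k"
      then have t: "tableau (A - {Suc n}) {1..n}" and cA: "card A = k"
        unfolding tableau_Suc_iff by auto
      show "A \<in> ?T n k \<union> insert (Suc n) ` ?T n (k - 1)"
      proof (cases "Suc n \<in> A")
        case True
        then have "A - {Suc n} \<in> ?T n (k - 1)" using t cA by (simp add: card_Diff_singleton)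
        moreover have "A = insert (Suc n) (A - {Suc n})" using True by auto
        ultimately show ?thesis by blast
      next
        case False
        then have "A - {Suc n} = A" by blast
        then show ?thesis using t cA by simp
      qed
    next
      fix A assume "A \<in> ?T n k \<union> insert (Suc n) ` ?T n (k - 1)"
      then show "A \<in> ?T (Suc n) k"
      proof
        assume A: "A \<in> ?T n k"
        then have "Suc n \<notin> A" using sub[OF A] by auto
        then have "A - {Suc n} = A" by blast
        moreover have "A \<subseteq> {1..Suc n}" using sub[OF A] by auto
        ultimately show ?thesis using A False by (simp only: tableau_Suc_iff mem_Collect_eq not_less)
      next
        assume "A \<in> insert (Suc n) ` ?T n (k - 1)"
        then obtain A' where A': "A = insert (Suc n) A'" "A' \<in> ?T n (k - 1)" by blast
        then have new: "Suc n \<notin> A'" using sub[OF A'(2)] by auto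
        then have "A - {Suc n} = A'" unfolding A'(1) by blast
        moreover have "A \<subseteq> {1..Suc n}" unfolding A'(1) using sub[OF A'(2)] by auto
        moreover have "card A = k" unfolding A'(1) using new sub[OF A'(2)] A'(2) k by simp
        ultimately show ?thesis
          using A'(2) False by (simp only: tableau_Suc_iff mem_Collect_eq not_less)
      qed
    qed
    moreover have "?T n k \<inter> insert (Suc n) ` ?T n (k - 1) = {}"
    proof -
      have "Suc n \<notin> A" if "A \<in> ?T n k" for A using sub[OF that] by auto
      then show ?thesis by blast
    qed
    moreover have "inj_on (insert (Suc n)) (?T n (k - 1))"
    proof (rule inj_onI)
      fix A A' assume *: "A \<in> ?T n (k - 1)" "A' \<in> ?T n (k - 1)" "insert (Suc n) A = insert (Suc n) A'"
      have "Suc n \<notin> A" "Suc n \<notin> A'" using sub[OF *(1)] sub[OF *(2)] by auto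
      then show "A = A'" by (rule insert_ident[THEN iffD1, OF _ _ *(3)])
    qed
    ultimately have "card (?T (Suc n) k) = card (?T n k) + card (?T n (k - 1))"
      using fin[of n k] fin[of n "k - 1"] by (simp only: card_Un_disjoint card_image finite_imageI)
    then show ?thesis using False by (simp only: Suc.IH ballot.simps if_False)
  qed
qed

section \<open>From permutations to words\<close>

primrec word :: "(nat \<Rightarrow> nat) \<Rightarrow> nat \<Rightarrow> nat list" where
  "word p 0 = []"
| "word p (Suc i) = p (Suc i) # word p i"

lemma set_word: "set (word p i) = p ` {1..i}"
  by (induction i) (auto simp: atLeastAtMostSuc_conv)

lemma distinct_word: "distinct (word p i) \<longleftrightarrow> inj_on p {1..i}"
  by (induction i) (auto simp: atLeastAtMostSuc_conv set_word)

lemma word_eq_iff: "word p i = word q i \<longleftrightarrow> (\<forall>j\<in>{1..i}. p j = q j)"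
  by (induction i) (auto simp: atLeastAtMostSuc_conv)

lemma ex_word: "\<exists>p. word p (length w) = w"
proof (induction w)
  case (Cons a w)
  then obtain p where p: "word p (length w) = w" by blast
  have "word (p(Suc (length w) := a)) (length w) = word p (length w)"
    by (simp add: word_eq_iff)
  then have "word (p(Suc (length w) := a)) (length (a # w)) = a # w" using p by simp
  then show ?case by blast
qed simp

lemma bij_betw_word:
  "bij_betw (\<lambda>p. word p n) {p. p permutes {1..n}} {w. distinct w \<and> set w = {1..n}}"
proof (rule bij_betwI')
  fix p q assume "p \<in> {p. p permutes {1..n}}" "q \<in> {p. p permutes {1..n}}"
  then have "p j = q j" if "j \<notin> {1..n}" for j using that by (simp add: permutes_not_in)
  then show "word p n = word q n \<longleftrightarrow> p = q"
    unfolding word_eq_iff fun_eq_iff by blast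
next
  fix p assume "p \<in> {p. p permutes {1..n}}"
  then show "word p n \<in> {w. distinct w \<and> set w = {1..n}}"
    by (auto simp: distinct_word set_word permutes_inj_on permutes_image)
next
  fix w :: "nat list" assume w: "w \<in> {w. distinct w \<and> set w = {1..n}}"
  then have "length w = n" using distinct_card[of w] by simp
  then obtain f where f: "word f n = w" using ex_word by blast
  define p where "p i = (if i \<in> {1..n} then f i else i)" for i
  have pw: "word p n = w" unfolding f[symmetric] word_eq_iff by (simp add: p_def)
  have "bij_betw p {1..n} {1..n}"
    using w unfolding pw[symmetric] mem_Collect_eq distinct_word set_word bij_betw_def by blast
  then have "p permutes {1..n}" by (rule bij_imp_permutes) (auto simp: p_def)
  then show "\<exists>p\<in>{p. p permutes {1..n}}. w = word p n" using pw by blast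
qed

lemma sorted_above_word:
  "sorted_wrt (>) (filter ((<) a) (word p i)) \<longleftrightarrow>
     (\<forall>s\<in>{1..i}. \<forall>t\<in>{1..i}. s < t \<longrightarrow> a < p s \<longrightarrow> a < p t \<longrightarrow> p s < p t)"
  by (induction i) (auto simp: atLeastAtMostSuc_conv set_word)

lemma avoids_321_iff:
  "avoids_321 n p \<longleftrightarrow>
     \<not> (\<exists>r\<in>{1..n}. \<exists>s\<in>{1..n}. \<exists>t\<in>{1..n}. r < s \<and> s < t \<and> p t < p s \<and> p s < p r)"
proof -
  have "(\<exists>S\<subseteq>{1..n}. card S = 3 \<and> strict_antimono_on S p) \<longleftrightarrow>
     (\<exists>r\<in>{1..n}. \<exists>s\<in>{1..n}. \<exists>t\<in>{1..n}. r < s \<and> s < t \<and> p t < p s \<and> p s < p r)"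
  proof
    assume "\<exists>S\<subseteq>{1..n}. card S = 3 \<and> strict_antimono_on S p"
    then obtain S where S: "S \<subseteq> {1..n}" "card S = 3" "strict_antimono_on S p" by blast
    define l where "l = sorted_list_of_set S"
    have fin: "finite S" using S(1) finite_subset by blast
    have l: "sorted_wrt (<) l" "set l = S" "length l = 3"
      using fin S(2) by (auto simp: l_def)
    then obtain r s t where "l = [r, s, t]" by (auto simp: numeral_3_eq_3 length_Suc_conv)
    then have "r < s" "s < t" "r \<in> S" "s \<in> S" "t \<in> S" using l by auto
    then show "\<exists>r\<in>{1..n}. \<exists>s\<in>{1..n}. \<exists>t\<in>{1..n}. r < s \<and> s < t \<and> p t < p s \<and> p s < p r"
      using S(1,3) by (meson monotone_onD subsetD)
  next
    assume "\<exists>r\<in>{1..n}. \<exists>s\<in>{1..n}. \<exists>t\<in>{1..n}. r < s \<and> s < t \<and> p t < p s \<and> p s < p r"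
    then obtain r s t where *: "r \<in> {1..n}" "s \<in> {1..n}" "t \<in> {1..n}"
      "r < s" "s < t" "p t < p s" "p s < p r" by blast
    then have "card {r, s, t} = 3" "strict_antimono_on {r, s, t} p"
      by (auto simp: monotone_on_def)
    then show "\<exists>S\<subseteq>{1..n}. card S = 3 \<and> strict_antimono_on S p"
      using * by (intro exI[of _ "{r, s, t}"]) auto
  qed
  then show ?thesis by (simp add: avoids_321_def)
qed

lemma avoiding_word:
  assumes "inj_on p {1..i}"
  shows "avoiding (word p i) \<longleftrightarrow> avoids_321 i p"
  using assms
proof (induction i)
  case 0
  then show ?case by (simp add: avoids_321_iff)
next
  case (Suc i)
  have inj: "inj_on p {1..i}" by (rule inj_on_subset[OF Suc.prems]) auto
  have "p s < p t \<longleftrightarrow> \<not> p t < p s" if "s \<in> {1..i}" "t \<in> {1..i}" "s < t" for s t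
    using inj_onD[OF inj _ that(1,2)] that(3) by (metis linorder_neqE_nat order.asym nat_less_le)
  then have "(\<forall>s\<in>{1..i}. \<forall>t\<in>{1..i}. s < t \<longrightarrow> p (Suc i) < p s \<longrightarrow> p (Suc i) < p t \<longrightarrow> p s < p t)
      \<longleftrightarrow> \<not> (\<exists>s\<in>{1..i}. \<exists>t\<in>{1..i}. s < t \<and> p (Suc i) < p t \<and> p t < p s)"
    by (meson less_trans)
  moreover have "avoids_321 (Suc i) p \<longleftrightarrow> avoids_321 i p \<and>
      \<not> (\<exists>s\<in>{1..i}. \<exists>t\<in>{1..i}. s < t \<and> p (Suc i) < p t \<and> p t < p s)"
    unfolding avoids_321_iff by (auto simp: atLeastAtMostSuc_conv)
  ultimately show ?case using Suc.IH[OF inj] by (simp add: sorted_above_word)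
qed

section \<open>The longest increasing subsequence\<close>

text \<open>
  The bound \<open>v\<close> on the values makes the induction on the length of the word go through: an increasing
  subsequence that ends with the new letter \<open>a\<close> has its other values below \<open>a\<close>.
\<close>

lemma increasing_card_le_first_row:
  assumes "inj_on p {1..i}" "S \<subseteq> {1..i}" "strict_mono_on S p" "p ` S \<subseteq> {..<v}"
  shows "card S \<le> card (first_row (word p i) \<inter> {..<v})"
  using assms
proof (induction i arbitrary: S v)
  case 0
  then show ?case by simp
next
  case (Suc i)
  let ?A = "first_row (word p i)" and ?a = "p (Suc i)"
  have inj: "inj_on p {1..i}" by (rule inj_on_subset[OF Suc.prems(1)]) auto
  have "distinct (word p (Suc i))" using Suc.prems(1) by (simp only: distinct_word)
  then have "?a \<notin> set (word p i)" by simp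
  then have a: "?a \<notin> ?A" using first_row_subset[of "word p i"] by blast
  show ?case
  proof (cases "Suc i \<in> S")
    case True
    let ?S = "S - {Suc i}"
    have sub: "?S \<subseteq> {1..i}" using Suc.prems(2) by (auto simp: le_Suc_eq)
    have mono: "strict_mono_on ?S p" using Suc.prems(3) by (rule monotone_on_subset) auto
    have "p j < ?a" if "j \<in> ?S" for j
    proof -
      have "j < Suc i" "j \<in> S" using sub that by auto
      then show ?thesis using monotone_onD[OF Suc.prems(3) _ True] by blast
    qed
    then have "p ` ?S \<subseteq> {..<?a}" by blast
    then have "card ?S \<le> card (?A \<inter> {..<?a})" by (rule Suc.IH[OF inj sub mono])
    moreover have "card S = Suc (card ?S)"
      using finite_subset[OF Suc.prems(2)] True by (intro card.remove) auto
    moreover have "?a < v" using True Suc.prems(4) by auto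
    ultimately show ?thesis
      unfolding word.simps first_row.simps
      by (simp only: card_insert_row_below[OF finite_first_row a] max.coboundedI2 Suc_le_mono)
  next
    case False
    have "S \<subseteq> {1..i}"
    proof
      fix x assume "x \<in> S"
      then have "x \<in> {1..Suc i}" "x \<noteq> Suc i" using Suc.prems(2) False by blast+
      then show "x \<in> {1..i}" by simp
    qed
    then have "card S \<le> card (?A \<inter> {..<v})" by (rule Suc.IH[OF inj _ Suc.prems(3,4)])
    also have "\<dots> \<le> card (first_row (word p (Suc i)) \<inter> {..<v})"
      using card_insert_row_below[OF finite_first_row a, of v] insert_row_below[of v ?a ?A]
      by (cases "v \<le> ?a") auto
    finally show ?thesis .
  qed
qed

lemma increasing_card_eq_first_row:
  assumes "inj_on p {1..i}"
  shows "\<exists>S\<subseteq>{1..i}. strict_mono_on S p \<and> p ` S \<subseteq> {..<v} \<and>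
    card S = card (first_row (word p i) \<inter> {..<v})"
  using assms
proof (induction i arbitrary: v)
  case 0
  then show ?case by simp
next
  case (Suc i)
  let ?A = "first_row (word p i)" and ?a = "p (Suc i)" and ?A' = "first_row (word p (Suc i))"
  have inj: "inj_on p {1..i}" by (rule inj_on_subset[OF Suc.prems(1)]) auto
  have "distinct (word p (Suc i))" using Suc.prems(1) by (simp only: distinct_word)
  then have "?a \<notin> set (word p i)" by simp
  then have a: "?a \<notin> ?A" using first_row_subset[of "word p i"] by blast
  have "card (?A' \<inter> {..<v}) = card (?A \<inter> {..<v}) \<or>
      ?a < v \<and> card (?A' \<inter> {..<v}) = Suc (card (?A \<inter> {..<?a}))"
    using card_insert_row_below[OF finite_first_row a, of v] insert_row_below[of v ?a ?A]
    by (cases "v \<le> ?a") auto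
  then show ?case
  proof
    assume "card (?A' \<inter> {..<v}) = card (?A \<inter> {..<v})"
    moreover obtain S where "S \<subseteq> {1..i}" "strict_mono_on S p" "p ` S \<subseteq> {..<v}"
      "card S = card (?A \<inter> {..<v})" using Suc.IH[OF inj, of v] by blast
    moreover from this have "S \<subseteq> {1..Suc i}" by auto
    ultimately show ?thesis by metis
  next
    assume *: "?a < v \<and> card (?A' \<inter> {..<v}) = Suc (card (?A \<inter> {..<?a}))"
    obtain S where S: "S \<subseteq> {1..i}" "strict_mono_on S p" "p ` S \<subseteq> {..<?a}"
      "card S = card (?A \<inter> {..<?a})" using Suc.IH[OF inj, of ?a] by blast
    have "finite S" "Suc i \<notin> S" using S(1) finite_subset by auto
    then have "card (insert (Suc i) S) = card (?A' \<inter> {..<v})" using * S(4) by simp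
    moreover have "strict_mono_on (insert (Suc i) S) p"
    proof (rule monotone_onI)
      fix x y assume xy: "x \<in> insert (Suc i) S" "y \<in> insert (Suc i) S" "x < y"
      then have "x \<noteq> Suc i" using S(1) by auto
      then have x: "x \<in> S" using xy(1) by blast
      show "p x < p y"
      proof (cases "y = Suc i")
        case True
        then show ?thesis using S(3) x by blast
      next
        case False
        then show ?thesis using monotone_onD[OF S(2) x _ xy(3)] xy(2) by blast
      qed
    qed
    moreover have "p ` insert (Suc i) S \<subseteq> {..<v}"
    proof -
      have "p j < v" if "j \<in> S" for j
        using S(3) that * less_trans[of "p j" ?a v] by blast
      then show ?thesis using * by blast
    qed
    moreover have "insert (Suc i) S \<subseteq> {1..Suc i}" using S(1) by auto
    ultimately show ?thesis by blast
  qed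
qed

lemma lis_eq_card_first_row:
  assumes "inj_on p {1..n}"
  shows "lis n p = card (first_row (word p n))"
  unfolding lis_def
proof (rule Max_eqI)
  let ?A = "first_row (word p n)"
  have "{card S |S. S \<subseteq> {1..n} \<and> strict_mono_on S p} \<subseteq> card ` Pow {1..n}" by auto
  then show "finite {card S |S. S \<subseteq> {1..n} \<and> strict_mono_on S p}"
    by (rule finite_subset) simp
  \<comment> \<open>A bound above all values turns the counts below \<open>v\<close> into counts of everything.\<close>
  define v where "v = Suc (Max (p ` {1..n}))"
  have below: "p ` {1..n} \<subseteq> {..<v}" unfolding v_def by (auto simp: less_Suc_eq_le)
  then have A: "?A \<inter> {..<v} = ?A"
    using first_row_subset[of "word p n"] unfolding set_word by blast
  show "y \<le> card ?A" if y: "y \<in> {card S |S. S \<subseteq> {1..n} \<and> strict_mono_on S p}" for y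
  proof -
    from y obtain S where S: "y = card S" "S \<subseteq> {1..n}" "strict_mono_on S p" by blast
    then have "p ` S \<subseteq> {..<v}" using below by blast
    then show ?thesis using increasing_card_le_first_row[OF assms S(2,3), of v]
      unfolding A S(1) by blast
  qed
  show "card ?A \<in> {card S |S. S \<subseteq> {1..n} \<and> strict_mono_on S p}"
    using increasing_card_eq_first_row[OF assms, of v] unfolding A mem_Collect_eq by metis
qed

section \<open>Log-concavity\<close>

lemma b_eq_ballot_squared: "b n k = (ballot n k)\<^sup>2"
proof -
  let ?P = "{p. p permutes {1..n} \<and> avoids_321 n p \<and> lis n p = k}"
  let ?T = "{A. tableau A {1..n} \<and> card A = k}"
  have good: "avoids_321 n p \<and> lis n p = k \<longleftrightarrow> avoiding (word p n) \<and> card (first_row (word p n)) = k"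
    if "p permutes {1..n}" for p
    using that by (simp add: avoiding_word lis_eq_card_first_row permutes_inj_on)
  have bij: "bij_betw (\<lambda>p. word p n) ?P
      {w. distinct w \<and> set w = {1..n} \<and> avoiding w \<and> card (first_row w) = k}"
  proof (rule bij_betw_subset[OF bij_betw_word])
    show "?P \<subseteq> {p. p permutes {1..n}}" by blast
    show "(\<lambda>p. word p n) ` ?P =
        {w. distinct w \<and> set w = {1..n} \<and> avoiding w \<and> card (first_row w) = k}"
    proof (intro equalityI subsetI)
      fix w assume "w \<in> (\<lambda>p. word p n) ` ?P"
      then obtain p where p: "p \<in> ?P" "w = word p n" by blast
      then have "w \<in> {w. distinct w \<and> set w = {1..n}}"
        using bij_betwE[OF bij_betw_word[of n]] by blast
      then show "w \<in> {w. distinct w \<and> set w = {1..n} \<and> avoiding w \<and> card (first_row w) = k}"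
        using p good by auto
    next
      fix w assume w: "w \<in> {w. distinct w \<and> set w = {1..n} \<and> avoiding w \<and> card (first_row w) = k}"
      then have "w \<in> (\<lambda>p. word p n) ` {p. p permutes {1..n}}"
        using bij_betw_imp_surj_on[OF bij_betw_word[of n]] by simp
      then obtain p where "p permutes {1..n}" "w = word p n" by blast
      then show "w \<in> (\<lambda>p. word p n) ` ?P" using w good by auto
    qed
  qed
  have "{w. distinct w \<and> set w = {1..n} \<and> avoiding w \<and> card (first_row w) = k} =
      (\<Union>A\<in>?T. words_with_row A {1..n})" (is "?W = ?U")
  proof (intro equalityI subsetI)
    fix w assume w: "w \<in> ?W"
    then have "tableau (first_row w) {1..n}" using tableau_first_row[of w] by simp
    then have "first_row w \<in> ?T" using w by simp
    moreover have "w \<in> words_with_row (first_row w) {1..n}"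
      using w by (simp add: words_with_row_def)
    ultimately show "w \<in> ?U" by (rule UN_I)
  next
    fix w assume "w \<in> ?U"
    then show "w \<in> ?W" by (auto simp: words_with_row_def)
  qed
  then have "b n k = card (\<Union>A\<in>?T. words_with_row A {1..n})"
    using bij_betw_same_card[OF bij] by (simp add: b_def)
  also have "\<dots> = (\<Sum>A\<in>?T. card (words_with_row A {1..n}))"
  proof (rule card_UN_disjoint)
    show "finite ?T"
      by (rule finite_subset[of _ "Pow {1..n}"]) (auto simp: tableau_def)
    show "\<forall>A\<in>?T. finite (words_with_row A {1..n})" by (simp add: finite_words_with_row)
  qed (auto simp: words_with_row_def)
  also have "\<dots> = (\<Sum>A\<in>?T. ballot n k)"
    by (rule sum.cong) (auto simp: card_words_with_row)
  also have "\<dots> = (ballot n k)\<^sup>2"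
    by (simp only: sum_constant card_standard_tableaux) (simp add: power2_eq_square)
  finally show ?thesis .
qed

theorem corollary4p3:
  fixes n :: nat
  assumes "0 < n"
  shows "log_concave_on {k. real n / 2 \<le> real k \<and> k \<le> n} (\<lambda>k. real (b n k))"
  unfolding log_concave_on_def
proof (intro conjI ballI allI impI)
  have half: "real n / 2 \<le> real k \<longleftrightarrow> n \<le> 2 * k" for k by linarith
  show "0 < real (b n k)" if "k \<in> {k. real n / 2 \<le> real k \<and> k \<le> n}" for k
    using that ballot_pos[of n k] by (simp add: half b_eq_ballot_squared)
  show "real (b n (k - 1)) * real (b n (k + 1)) \<le> (real (b n k))\<^sup>2"
    if k: "1 \<le> k \<and> k - 1 \<in> {k. real n / 2 \<le> real k \<and> k \<le> n} \<and>
      k \<in> {k. real n / 2 \<le> real k \<and> k \<le> n} \<and> k + 1 \<in> {k. real n / 2 \<le> real k \<and> k \<le> n}" for k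
  proof -
    have "ballot n (k - 1) * ballot n (k + 1) \<le> (ballot n k)\<^sup>2"
      using k unfolding mem_Collect_eq half by (intro ballot_log_concave) auto
    then have "(ballot n (k - 1) * ballot n (k + 1))\<^sup>2 \<le> ((ballot n k)\<^sup>2)\<^sup>2"
      by (rule power_mono) simp
    then have "b n (k - 1) * b n (k + 1) \<le> (b n k)\<^sup>2"
      by (simp only: b_eq_ballot_squared power_mult_distrib)
    then have "real (b n (k - 1) * b n (k + 1)) \<le> real ((b n k)\<^sup>2)" by (simp only: of_nat_le_iff)
    then show ?thesis by simp
  qed
qed

end
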